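(* Let $(X,\unlhd,\wedge,\vee,0,1)$ be a bounded trellis, $T$ a pseudo-t-norm on $X$ and $T^*$ a t-norm on $X$. If $T$ is $T^*$-distributive, then $T$ is weaker than $T^*$, i.e. $T(x,y)\unlhd T^*(x,y)$ for all $x,y\in X$.
   Context: A pseudo-order $\unlhd$ on a set $X$ is a reflexive and antisymmetric relation (not necessarily transitive); lower/upper bounds, infima and suprema are defined as for partially ordered sets (they are unique when they exist). A trellis $(X,\unlhd,\wedge,\vee)$ is a set with a pseudo-order in which any two elements $x,y$ have an infimum $x\wedge y$ and a supremum $x\vee y$. It is bounded, written $(X,\unlhd,\wedge,\vee,0,1)$, if it has elements $0,1$ with $0\unlhd x\unlhd 1$ for all $x\in X$. An element $\alpha\in X$ is right-transitive if $\alpha\unlhd x\unlhd y$ implies $\alpha\unlhd y$; left-transitive if $x\unlhd y\unlhd\alpha$ implies $x\unlhd\alpha$; middle-transitive if $x\unlhd\alpha\unlhd y$ implies $x\unlhd y$ (for all $x,y\in X$); transitive if all three hold. A triple $(x,y,z)$ is $\wedge$-associative if $(x\wedge y)\wedge z=x\wedge(y\wedge z)$, and $\vee$-associative if $(x\vee y)\vee z=x\vee(y\vee z)$. An element is $\wedge$-associative (resp. $\vee$-associative) if every triple in $X^3$ containing it is $\wedge$-associative (resp. $\vee$-associative). A binary operation $F$ on $X$ is weakly-increasing if, whenever $x\unlhd y$ and at least one of $x,y$ is transitive, $F(x,z)\unlhd F(y,z)$ for all $z\in X$. It is weakly-associative if $F(x,F(y,z))=F(F(x,y),z)$ for all $x,y,z\in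 X$ such that at least one of $x,y,z$ is $\wedge$-associative or at least one of $x,y,z$ is $\vee$-associative. A pseudo-t-norm on $X$ is a commutative, weakly-increasing, weakly-associative binary operation $T$ with $T(1,x)=x$ for all $x\in X$. A t-norm on $X$ is a commutative, associative binary operation $T$ that is increasing ($x\unlhd y$ implies $T(x,z)\unlhd T(y,z)$ for all $z\in X$) and satisfies $T(1,x)=x$ for all $x\in X$. For binary operations $F_1,F_2$ on $X$, $F_1$ is $F_2$-distributive if $F_1(x,F_2(y,z))=F_2(F_1(x,y),F_1(x,z))$ for all $x,y,z\in X$ with $(y,z)\neq(0,0)$ and $(y,z)\neq(1,1)$. *)

theory Defs
  imports "HOL-Library.FuncSet"
begin

locale pseudo_order =
  fixes X :: "'a set" and le :: "'a \<Rightarrow> 'a \<Rightarrow> bool" (infix "\<unlhd>" 50)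
  assumes refl: "reflp_on X (\<unlhd>)"
    and antisym: "antisymp_on X (\<unlhd>)"
begin

definition lower_bound :: "'a set \<Rightarrow> 'a \<Rightarrow> bool" where
  "lower_bound A l \<longleftrightarrow> l \<in> X \<and> (\<forall>a\<in>A. l \<unlhd> a)"

definition upper_bound :: "'a set \<Rightarrow> 'a \<Rightarrow> bool" where
  "upper_bound A u \<longleftrightarrow> u \<in> X \<and> (\<forall>a\<in>A. a \<unlhd> u)"

definition is_infimum :: "'a set \<Rightarrow> 'a \<Rightarrow> bool" where
  "is_infimum A m \<longleftrightarrow> lower_bound A m \<and> (\<forall>l. lower_bound A l \<longrightarrow> l \<unlhd> m)"

definition is_supremum :: "'a set \<Rightarrow> 'a \<Rightarrow> bool" where
  "is_supremum A s \<longleftrightarrow> upper_bound A s \<and> (\<forall>u. upper_bound A u \<longrightarrow> s \<unlhd> u)"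

definition right_transitive :: "'a \<Rightarrow> bool" where
  "right_transitive \<alpha> \<longleftrightarrow> (\<forall>x\<in>X. \<forall>y\<in>X. \<alpha> \<unlhd> x \<and> x \<unlhd> y \<longrightarrow> \<alpha> \<unlhd> y)"

definition left_transitive :: "'a \<Rightarrow> bool" where
  "left_transitive \<alpha> \<longleftrightarrow> (\<forall>x\<in>X. \<forall>y\<in>X. x \<unlhd> y \<and> y \<unlhd> \<alpha> \<longrightarrow> x \<unlhd> \<alpha>)"

definition middle_transitive :: "'a \<Rightarrow> bool" where
  "middle_transitive \<alpha> \<longleftrightarrow> (\<forall>x\<in>X. \<forall>y\<in>X. x \<unlhd> \<alpha> \<and> \<alpha> \<unlhd> y \<longrightarrow> x \<unlhd> y)"

definition transitive_element :: "'a \<Rightarrow> bool" where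
  "transitive_element \<alpha> \<longleftrightarrow>
     right_transitive \<alpha> \<and> left_transitive \<alpha> \<and> middle_transitive \<alpha>"

definition increasing :: "('a \<Rightarrow> 'a \<Rightarrow> 'a) \<Rightarrow> bool" where
  "increasing F \<longleftrightarrow> (\<forall>x\<in>X. \<forall>y\<in>X. x \<unlhd> y \<longrightarrow> (\<forall>z\<in>X. F x z \<unlhd> F y z))"

definition weakly_increasing :: "('a \<Rightarrow> 'a \<Rightarrow> 'a) \<Rightarrow> bool" where
  "weakly_increasing F \<longleftrightarrow>
     (\<forall>x\<in>X. \<forall>y\<in>X. x \<unlhd> y \<and> (transitive_element x \<or> transitive_element y)
        \<longrightarrow> (\<forall>z\<in>X. F x z \<unlhd> F y z))"

definition weaker :: "('a \<Rightarrow> 'a \<Rightarrow> 'a) \<Rightarrow> ('a \<Rightarrow> 'a \<Rightarrow> 'a) \<Rightarrow> bool" where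
  "weaker F G \<longleftrightarrow> (\<forall>x\<in>X. \<forall>y\<in>X. F x y \<unlhd> G x y)"

end

locale trellis = pseudo_order X le
  for X :: "'a set" and le :: "'a \<Rightarrow> 'a \<Rightarrow> bool" (infix "\<unlhd>" 50) +
  fixes meet :: "'a \<Rightarrow> 'a \<Rightarrow> 'a" (infixl "\<sqinter>" 70)
    and join :: "'a \<Rightarrow> 'a \<Rightarrow> 'a" (infixl "\<squnion>" 65)
  assumes meet: "x \<in> X \<Longrightarrow> y \<in> X \<Longrightarrow> is_infimum {x, y} (x \<sqinter> y)"
    and join: "x \<in> X \<Longrightarrow> y \<in> X \<Longrightarrow> is_supremum {x, y} (x \<squnion> y)"
begin

definition meet_associative :: "'a \<Rightarrow> bool" where
  "meet_associative \<alpha> \<longleftrightarrow>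
     (\<forall>x\<in>X. \<forall>y\<in>X. \<forall>z\<in>X. \<alpha> \<in> {x, y, z} \<longrightarrow> (x \<sqinter> y) \<sqinter> z = x \<sqinter> (y \<sqinter> z))"

definition join_associative :: "'a \<Rightarrow> bool" where
  "join_associative \<alpha> \<longleftrightarrow>
     (\<forall>x\<in>X. \<forall>y\<in>X. \<forall>z\<in>X. \<alpha> \<in> {x, y, z} \<longrightarrow> (x \<squnion> y) \<squnion> z = x \<squnion> (y \<squnion> z))"

definition weakly_associative :: "('a \<Rightarrow> 'a \<Rightarrow> 'a) \<Rightarrow> bool" where
  "weakly_associative F \<longleftrightarrow>
     (\<forall>x\<in>X. \<forall>y\<in>X. \<forall>z\<in>X.
        (\<exists>\<alpha>\<in>{x, y, z}. meet_associative \<alpha>) \<or> (\<exists>\<alpha>\<in>{x, y, z}. join_associative \<alpha>)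
        \<longrightarrow> F x (F y z) = F (F x y) z)"

end

locale bounded_trellis = trellis X le meet join
  for X :: "'a set" and le :: "'a \<Rightarrow> 'a \<Rightarrow> bool" (infix "\<unlhd>" 50)
    and meet :: "'a \<Rightarrow> 'a \<Rightarrow> 'a" (infixl "\<sqinter>" 70)
    and join :: "'a \<Rightarrow> 'a \<Rightarrow> 'a" (infixl "\<squnion>" 65) +
  fixes zero :: 'a ("\<zero>") and one :: 'a ("\<one>")
  assumes zero_closed: "\<zero> \<in> X"
    and one_closed: "\<one> \<in> X"
    and zero_le: "x \<in> X \<Longrightarrow> \<zero> \<unlhd> x"
    and le_one: "x \<in> X \<Longrightarrow> x \<unlhd> \<one>"
begin

definition pseudo_t_norm :: "('a \<Rightarrow> 'a \<Rightarrow> 'a) \<Rightarrow> bool" where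
  "pseudo_t_norm T \<longleftrightarrow>
     T \<in> X \<rightarrow> X \<rightarrow> X \<and>
     (\<forall>x\<in>X. \<forall>y\<in>X. T x y = T y x) \<and>
     weakly_increasing T \<and>
     weakly_associative T \<and>
     (\<forall>x\<in>X. T \<one> x = x)"

definition t_norm :: "('a \<Rightarrow> 'a \<Rightarrow> 'a) \<Rightarrow> bool" where
  "t_norm T \<longleftrightarrow>
     T \<in> X \<rightarrow> X \<rightarrow> X \<and>
     (\<forall>x\<in>X. \<forall>y\<in>X. T x y = T y x) \<and>
     (\<forall>x\<in>X. \<forall>y\<in>X. \<forall>z\<in>X. T x (T y z) = T (T x y) z) \<and>
     increasing T \<and>
     (\<forall>x\<in>X. T \<one> x = x)"

text \<open>\<open>distributive F G\<close> reads: \<open>F\<close> is \<open>G\<close>-distributive. The pairs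
  \<open>(\<zero>, \<zero>)\<close> and \<open>(\<one>, \<one>)\<close> are exempt: with \<open>F\<close> and \<open>G\<close> both t-norms, the pair
  \<open>(\<one>, \<one>)\<close> would force \<open>x = G x x\<close> for every \<open>x\<close>.\<close>

definition distributive :: "('a \<Rightarrow> 'a \<Rightarrow> 'a) \<Rightarrow> ('a \<Rightarrow> 'a \<Rightarrow> 'a) \<Rightarrow> bool" where
  "distributive F G \<longleftrightarrow>
     (\<forall>x\<in>X. \<forall>y\<in>X. \<forall>z\<in>X. (y, z) \<noteq> (\<zero>, \<zero>) \<and> (y, z) \<noteq> (\<one>, \<one>)
        \<longrightarrow> F x (G y z) = G (F x y) (F x z))"

end

end

theory Submission
  imports Defs
begin

text \<open>
  Let \<open>t = T x y\<close>. If \<open>x\<close> or \<open>y\<close> is the top element, both operations return the other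
  argument, and reflexivity gives the claim. Otherwise neither \<open>(y, \<one>)\<close> nor \<open>(x, \<one>)\<close>
  is an exempt pair, so multiplying \<open>y = T\<^sup>* y \<one>\<close> by \<open>x\<close> and \<open>x = T\<^sup>* x \<one>\<close> by \<open>y\<close>
  shows that \<open>t\<close> absorbs both arguments: \<open>t = T\<^sup>* t x\<close> and \<open>t = T\<^sup>* t y\<close>.
  Associativity combines these into \<open>t = T\<^sup>* t (T\<^sup>* x y)\<close>, and monotonicity of \<open>T\<^sup>*\<close>
  along \<open>t \<unlhd> \<one>\<close> bounds the right-hand side by \<open>T\<^sup>* \<one> (T\<^sup>* x y) = T\<^sup>* x y\<close>.
\<close>

context bounded_trellis
begin

text \<open>An element fixed by multiplication with \<open>x\<close> and with \<open>y\<close> is fixed by multiplication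
  with their product, and a product lies below each of its factors.\<close>

lemma t_norm_absorbing_le:
  assumes S: "t_norm S" and X: "t \<in> X" "x \<in> X" "y \<in> X"
    and x: "S t x = t" and y: "S t y = t"
  shows "t \<unlhd> S x y"
proof -
  have Sxy: "S x y \<in> X"
    using S X unfolding t_norm_def by (meson PiE)
  have "t = S t (S x y)"
    using S X x y unfolding t_norm_def by metis
  also have "\<dots> \<unlhd> S \<one> (S x y)"
    using S X Sxy le_one one_closed unfolding t_norm_def increasing_def by blast
  also have "S \<one> (S x y) = S x y"
    using S Sxy unfolding t_norm_def by blast
  finally show ?thesis .
qed

text \<open>This is distributivity at the pair \<open>(y, \<one>)\<close>, where \<open>\<one>\<close> is neutral for both operations.\<close>

lemma distributive_absorbs_left:
  assumes T: "pseudo_t_norm T" and S: "t_norm S" and D: "distributive T S"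
    and X: "x \<in> X" "y \<in> X" and y: "y \<noteq> \<one>"
  shows "S (T x y) x = T x y"
proof -
  have Tx1: "T x \<one> = x" and Sy1: "S y \<one> = y"
    using T S X one_closed unfolding pseudo_t_norm_def t_norm_def by metis+
  \<comment> \<open>The pair is not \<open>(\<zero>, \<zero>)\<close> either, since that would give \<open>y = \<zero> = \<one>\<close>.\<close>
  have "(y, \<one>) \<noteq> (\<zero>, \<zero>)" "(y, \<one>) \<noteq> (\<one>, \<one>)"
    using y by auto
  then have "T x (S y \<one>) = S (T x y) (T x \<one>)"
    using D X one_closed unfolding distributive_def by blast
  then show ?thesis
    by (simp add: Tx1 Sy1)
qed

lemma distributive_imp_weaker:
  assumes T: "pseudo_t_norm T" and S: "t_norm S" and D: "distributive T S"
  shows "weaker T S"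
  unfolding weaker_def
proof (intro ballI)
  fix x y assume X: "x \<in> X" "y \<in> X"
  have comm: "T y x = T x y"
    using T X unfolding pseudo_t_norm_def by blast
  have closed: "T x y \<in> X"
    using T X unfolding pseudo_t_norm_def by (meson PiE)
  show "T x y \<unlhd> S x y"
  proof (cases "x = \<one> \<or> y = \<one>")
    case True
    then have "T x y = S x y"
      using T S X unfolding pseudo_t_norm_def t_norm_def by metis
    then show ?thesis
      using refl closed by (metis reflp_onD)
  next
    case False
    then have "S (T x y) x = T x y" "S (T x y) y = T x y"
      using distributive_absorbs_left[OF T S D X] distributive_absorbs_left[OF T S D X(2,1)] comm
      by auto
    then show ?thesis
      using t_norm_absorbing_le[OF S closed X] by blast
  qed
qed

end

theorem proposition5p3:
  fixes X :: "'a set" and le :: "'a \<Rightarrow> 'a \<Rightarrow> bool"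
    and meet join :: "'a \<Rightarrow> 'a \<Rightarrow> 'a" and zero one :: 'a
    and T Tstar :: "'a \<Rightarrow> 'a \<Rightarrow> 'a"
  assumes "bounded_trellis X le meet join zero one"
    and "bounded_trellis.pseudo_t_norm X le meet join one T"
    and "bounded_trellis.t_norm X le one Tstar"
    and "bounded_trellis.distributive X zero one T Tstar"
  shows "pseudo_order.weaker X le T Tstar"
  using bounded_trellis.distributive_imp_weaker[OF assms] .

end
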